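(* Let $a,b,c,\tilde a,\tilde b,\tilde c\in\mathbb{C}$ and let $$g=\begin{pmatrix} a & b\\ b & c\end{pmatrix},\qquad \tilde g=\begin{pmatrix}\tilde a & \tilde b\\ \tilde b & \tilde c\end{pmatrix}$$ be such that $\det(g)\neq 0$ and $\det(\tilde g)\neq 0$. Let $\mathcal{K}=(\mathcal{A}(x,y),g,\{x,y\})$ and $\tilde{\mathcal{K}}=(\mathcal{A}(x,y),\tilde g,\{x,y\})$ be the corresponding Kähler-Poisson algebras. Then $\mathcal{K}\cong\tilde{\mathcal{K}}$ (as Kähler-Poisson algebras) if and only if $c=\tilde c$.
   Context: $\mathcal{A}(x,y)$ denotes the Poisson algebra over $\mathbb{C}$ whose underlying commutative algebra is the field $\mathbb{C}(x,y)$ of rational functions in two variables, with the Poisson bracket determined by $\{x,y\}=x$ (extended from $\mathbb{C}[x,y]$ by the Leibniz rule). Explicitly, $\{f,h\}=x\left(\frac{\partial f}{\partial x}\frac{\partial h}{\partial y}-\frac{\partial f}{\partial y}\frac{\partial h}{\partial x}\right)$. Kähler-Poisson algebra: let $(\mathcal{A},\{\cdot,\cdot\})$ be a Poisson algebra over $\mathbb{C}$, $x^1,\dots,x^m\in\mathcal{A}$, and $g=(g_{ij})$ a symmetric $m\times m$ matrix with entries in $\mathcal{A}$. The triple $\mathcal{K}=(\mathcal{A},g,\{x^1,\dots,x^m\})$ is a Kähler-Poisson algebra if there exists $\eta\in\mathcal{A}$ such that $\sum_{i,j,k,l=1}^m\eta\{a,x^i\}g_{ij}\{x^j,x^k\}g_{kl}\{x^l,b\}=-\{a,b\}$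 for all $a,b\in\mathcal{A}$. In the triple $(\mathcal{A}(x,y),g,\{x,y\})$, the last entry is the set of distinguished elements $x^1=x$, $x^2=y$ (not a bracket). For such $\mathcal{K}$, let $\mathfrak{g}$ be the $\mathcal{A}$-module generated by all inner derivations $\{c,\cdot\}$, $c\in\mathcal{A}$; it is a Lie algebra under the commutator of derivations. Put $g(\alpha,\beta)=\sum_{i,j}\alpha(x^i)g_{ij}\beta(x^j)$ for $\alpha,\beta\in\mathfrak{g}$, and let $\mathcal{A}_{\mathrm{fin}}\subseteq\mathcal{A}$ be the subalgebra generated by $x^1,\dots,x^m$. A morphism of Kähler-Poisson algebras $\mathcal{K}\to\mathcal{K}'=(\mathcal{A}',g',\{y^1,\dots,y^{m'}\})$ is a pair $(\phi,\psi)$, with $\phi:\mathcal{A}\to\mathcal{A}'$ a (unital) Poisson algebra homomorphism and $\psi:\mathfrak{g}\to\mathfrak{g}'$ a Lie algebra homomorphism, such that for all $a\in\mathcal{A}$, $\alpha,\beta\in\mathfrak{g}$: (1) $\psi(a\alpha)=\phi(a)\psi(\alpha)$; (2) $\phi(\alpha(a))=\psi(\alpha)(\phi(a))$; (3) $\phi(g(\alpha,\beta))=g'(\psi(\alpha),\psi(\beta))$; (4) $\phi(\mathcal{A}_{\mathrm{fin}})\subseteq\mathcal{A}'_{\mathrm{fin}}$. $\mathcal{K}\cong\mathcal{K}'$ means there is such a morphism having an inverse morphism. *)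

theory Defs
  imports "HOL-Analysis.Determinants" "HOL-Computational_Algebra.Fraction_Field"
    "HOL-Computational_Algebra.Polynomial" "HOL-Library.FuncSet"
begin

section \<open>Poisson algebras over the complex numbers\<close>

locale poisson_algebra =
  vector_space smul
  for smul :: "complex \<Rightarrow> 'a::comm_ring_1 \<Rightarrow> 'a" +
  fixes brk :: "'a \<Rightarrow> 'a \<Rightarrow> 'a"
  assumes smul_mult: "smul t (f * h) = smul t f * h"
    and brk_add: "brk (f + f') h = brk f h + brk f' h"
    and brk_smul: "brk (smul t f) h = smul t (brk f h)"
    and brk_antisym: "brk f h = - brk h f"
    and brk_leibniz: "brk f (h * k) = brk f h * k + h * brk f k"
    and brk_jacobi: "brk f (brk h k) + brk h (brk k f) + brk k (brk f h) = 0"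

section \<open>Kaehler-Poisson algebras\<close>

text \<open>The underlying ring is the type \<open>'a\<close>; the distinguished elements
  \<open>x\<^sup>1, \<dots>, x\<^sup>m\<close> and the matrix \<open>g\<close> are indexed by a finite type \<open>'m\<close>.\<close>

record ('a, 'm) kp_structure =
  kp_smul :: "complex \<Rightarrow> 'a \<Rightarrow> 'a"
  kp_brk :: "'a \<Rightarrow> 'a \<Rightarrow> 'a"
  kp_metric :: "'a ^ 'm::finite ^ 'm"
  kp_gens :: "'a ^ 'm"

definition kahler_poisson :: "('a::comm_ring_1, 'm::finite) kp_structure \<Rightarrow> bool" where
  "kahler_poisson K \<longleftrightarrow>
     poisson_algebra (kp_smul K) (kp_brk K) \<and>
     transpose (kp_metric K) = kp_metric K \<and>
     (\<exists>\<eta>. \<forall>a b.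
        (\<Sum>i\<in>UNIV. \<Sum>j\<in>UNIV. \<Sum>k\<in>UNIV. \<Sum>l\<in>UNIV.
           \<eta> * kp_brk K a (kp_gens K $ i) * kp_metric K $ i $ j *
           kp_brk K (kp_gens K $ j) (kp_gens K $ k) * kp_metric K $ k $ l *
           kp_brk K (kp_gens K $ l) b) = - kp_brk K a b)"

definition kp_derivations :: "('a::comm_ring_1, 'm::finite) kp_structure \<Rightarrow> ('a \<Rightarrow> 'a) set" where
  "kp_derivations K =
     {\<alpha>. \<exists>(n::nat) u c. \<alpha> = (\<lambda>f. \<Sum>i<n. u i * kp_brk K (c i) f)}"

definition deriv_commutator :: "('a \<Rightarrow> 'a) \<Rightarrow> ('a \<Rightarrow> 'a) \<Rightarrow> 'a \<Rightarrow> 'a::comm_ring_1" where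
  "deriv_commutator \<alpha> \<beta> = (\<lambda>f. \<alpha> (\<beta> f) - \<beta> (\<alpha> f))"

definition kp_form ::
    "('a::comm_ring_1, 'm::finite) kp_structure \<Rightarrow> ('a \<Rightarrow> 'a) \<Rightarrow> ('a \<Rightarrow> 'a) \<Rightarrow> 'a" where
  "kp_form K \<alpha> \<beta> =
     (\<Sum>i\<in>UNIV. \<Sum>j\<in>UNIV. \<alpha> (kp_gens K $ i) * kp_metric K $ i $ j * \<beta> (kp_gens K $ j))"

definition is_subalgebra :: "(complex \<Rightarrow> 'a \<Rightarrow> 'a) \<Rightarrow> 'a::comm_ring_1 set \<Rightarrow> bool" where
  "is_subalgebra smul S \<longleftrightarrow>
     1 \<in> S \<and> (\<forall>f\<in>S. \<forall>h\<in>S. f + h \<in> S \<and> f * h \<in> S) \<and> (\<forall>t. \<forall>f\<in>S. smul t f \<in> S)"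

definition kp_fin :: "('a::comm_ring_1, 'm::finite) kp_structure \<Rightarrow> 'a set" where
  "kp_fin K = is_subalgebra (kp_smul K) hull range (\<lambda>i. kp_gens K $ i)"

definition poisson_hom ::
    "('a::comm_ring_1, 'm::finite) kp_structure \<Rightarrow> ('b::comm_ring_1, 'n::finite) kp_structure
      \<Rightarrow> ('a \<Rightarrow> 'b) \<Rightarrow> bool" where
  "poisson_hom K K' \<phi> \<longleftrightarrow>
     Vector_Spaces.linear (kp_smul K) (kp_smul K') \<phi> \<and>
     \<phi> 1 = 1 \<and>
     (\<forall>f h. \<phi> (f * h) = \<phi> f * \<phi> h) \<and>
     (\<forall>f h. \<phi> (kp_brk K f h) = kp_brk K' (\<phi> f) (\<phi> h))"

text \<open>The map \<open>\<psi>\<close> of a morphism is only meaningful on \<^term>\<open>kp_derivations K\<close>;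
  its values elsewhere are irrelevant.\<close>

definition derivation_lie_hom ::
    "('a::comm_ring_1, 'm::finite) kp_structure \<Rightarrow> ('b::comm_ring_1, 'n::finite) kp_structure
      \<Rightarrow> (('a \<Rightarrow> 'a) \<Rightarrow> ('b \<Rightarrow> 'b)) \<Rightarrow> bool" where
  "derivation_lie_hom K K' \<psi> \<longleftrightarrow>
     \<psi> \<in> kp_derivations K \<rightarrow> kp_derivations K' \<and>
     (\<forall>\<alpha>\<in>kp_derivations K. \<forall>\<beta>\<in>kp_derivations K.
        \<psi> (\<lambda>f. \<alpha> f + \<beta> f) = (\<lambda>f. \<psi> \<alpha> f + \<psi> \<beta> f) \<and>
        \<psi> (deriv_commutator \<alpha> \<beta>) = deriv_commutator (\<psi> \<alpha>) (\<psi> \<beta>)) \<and>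
     (\<forall>t. \<forall>\<alpha>\<in>kp_derivations K.
        \<psi> (\<lambda>f. kp_smul K t (\<alpha> f)) = (\<lambda>f. kp_smul K' t (\<psi> \<alpha> f)))"

definition kp_morphism ::
    "('a::comm_ring_1, 'm::finite) kp_structure \<Rightarrow> ('b::comm_ring_1, 'n::finite) kp_structure
      \<Rightarrow> ('a \<Rightarrow> 'b) \<Rightarrow> (('a \<Rightarrow> 'a) \<Rightarrow> ('b \<Rightarrow> 'b)) \<Rightarrow> bool" where
  "kp_morphism K K' \<phi> \<psi> \<longleftrightarrow>
     kahler_poisson K \<and> kahler_poisson K' \<and>
     poisson_hom K K' \<phi> \<and> derivation_lie_hom K K' \<psi> \<and>
     (\<forall>a. \<forall>\<alpha>\<in>kp_derivations K. \<psi> (\<lambda>f. a * \<alpha> f) = (\<lambda>f. \<phi> a * \<psi> \<alpha> f)) \<and>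
     (\<forall>a. \<forall>\<alpha>\<in>kp_derivations K. \<phi> (\<alpha> a) = \<psi> \<alpha> (\<phi> a)) \<and>
     (\<forall>\<alpha>\<in>kp_derivations K. \<forall>\<beta>\<in>kp_derivations K.
        \<phi> (kp_form K \<alpha> \<beta>) = kp_form K' (\<psi> \<alpha>) (\<psi> \<beta>)) \<and>
     \<phi> ` kp_fin K \<subseteq> kp_fin K'"

definition kp_isomorphic ::
    "('a::comm_ring_1, 'm::finite) kp_structure \<Rightarrow> ('b::comm_ring_1, 'n::finite) kp_structure
      \<Rightarrow> bool" where
  "kp_isomorphic K K' \<longleftrightarrow>
     (\<exists>\<phi> \<psi> \<phi>' \<psi>'. kp_morphism K K' \<phi> \<psi> \<and> kp_morphism K' K \<phi>' \<psi>' \<and>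
        (\<forall>a. \<phi>' (\<phi> a) = a) \<and> (\<forall>b. \<phi> (\<phi>' b) = b) \<and>
        (\<forall>\<alpha>\<in>kp_derivations K. \<psi>' (\<psi> \<alpha>) = \<alpha>) \<and>
        (\<forall>\<beta>\<in>kp_derivations K'. \<psi> (\<psi>' \<beta>) = \<beta>))"

section \<open>The Poisson field of rational functions in two variables\<close>

text \<open>\<open>\<complex>(x,y)\<close> is the fraction field of \<open>\<complex>[x][y]\<close>: the outer polynomial variable is \<open>y\<close>,
  the inner one is \<open>x\<close>.\<close>

type_synonym ratfun = "complex poly poly fract"

definition rf_const :: "complex \<Rightarrow> ratfun" where "rf_const t = Fract [:[:t:]:] 1"
definition rf_x :: ratfun where "rf_x = Fract [:[:0, 1:]:] 1"
definition rf_y :: ratfun where "rf_y = Fract [:0, 1:] 1"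

text \<open>The quotient-rule extension of a derivation \<open>D\<close> of an integral domain to its fraction field.\<close>

definition fract_deriv :: "('a::idom \<Rightarrow> 'a) \<Rightarrow> 'a fract \<Rightarrow> 'a fract" where
  "fract_deriv D f =
     (THE h. \<exists>p q. q \<noteq> 0 \<and> f = Fract p q \<and> h = Fract (D p * q - p * D q) (q * q))"

definition rf_dx :: "ratfun \<Rightarrow> ratfun" where "rf_dx = fract_deriv (map_poly pderiv)"
definition rf_dy :: "ratfun \<Rightarrow> ratfun" where "rf_dy = fract_deriv pderiv"

definition rf_brk :: "ratfun \<Rightarrow> ratfun \<Rightarrow> ratfun" where
  "rf_brk f h = rf_x * (rf_dx f * rf_dy h - rf_dy f * rf_dx h)"

definition kp_xy :: "ratfun ^ 2 ^ 2 \<Rightarrow> (ratfun, 2) kp_structure" where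
  "kp_xy g = \<lparr>kp_smul = (\<lambda>t f. rf_const t * f), kp_brk = rf_brk,
              kp_metric = g, kp_gens = vector [rf_x, rf_y]\<rparr>"

subsection \<open>Well-definedness\<close>

locale derivation =
  fixes D :: "'a::comm_ring_1 \<Rightarrow> 'a"
  assumes add: "D (f + h) = D f + D h"
    and mult: "D (f * h) = D f * h + f * D h"
begin

lemma zero: "D 0 = 0"
  using add[of 0 0] by simp

lemma one: "D 1 = 0"
  using mult[of 1 1] by simp

lemma minus: "D (- f) = - D f"
  using add[of f "- f"] zero by (simp add: eq_neg_iff_add_eq_0 add.commute)

lemma diff: "D (f - h) = D f - D h"
  using add[of f "- h"] minus by simp

end

lemma fract_deriv_Fract:
  fixes D :: "'a::idom \<Rightarrow> 'a"
  assumes "derivation D" "q \<noteq> 0"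
  shows "fract_deriv D (Fract p q) = Fract (D p * q - p * D q) (q * q)"
  unfolding fract_deriv_def
proof (rule the_equality)
  show "\<exists>p' q'. q' \<noteq> 0 \<and> Fract p q = Fract p' q' \<and>
          Fract (D p * q - p * D q) (q * q) = Fract (D p' * q' - p' * D q') (q' * q')"
    using assms by blast
next
  interpret derivation D by fact
  fix h
  assume "\<exists>p' q'. q' \<noteq> 0 \<and> Fract p q = Fract p' q' \<and> h = Fract (D p' * q' - p' * D q') (q' * q')"
  then obtain p' q' where *: "q' \<noteq> 0" "Fract p q = Fract p' q'"
      "h = Fract (D p' * q' - p' * D q') (q' * q')" by blast
  have e: "p * q' = p' * q" using * assms by (simp add: eq_fract)
  have d: "D p * q' + p * D q' = D p' * q + p' * D q"
    using arg_cong[OF e, of D] by (simp add: mult)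
  have "(D p' * q' - p' * D q') * (q * q) = (D p * q - p * D q) * (q' * q')"
  proof -
    have "(D p' * q' - p' * D q') * (q * q) - (D p * q - p * D q) * (q' * q')
      = q * q' * ((D p' * q + p' * D q) - (D p * q' + p * D q'))
        + (D q * q' + q * D q') * (p * q' - p' * q)"
      by (simp add: algebra_simps)
    then show ?thesis using d e by simp
  qed
  then show "h = Fract (D p * q - p * D q) (q * q)"
    using * assms by (simp add: eq_fract)
qed

lemma derivation_fract_deriv:
  fixes D :: "'a::idom \<Rightarrow> 'a"
  assumes "derivation D"
  shows "derivation (fract_deriv D)"
proof
  interpret derivation D by fact
  fix f h :: "'a fract"
  obtain p q where f: "f = Fract p q" "q \<noteq> 0" by (cases f rule: Fract_cases_nonzero) (auto simp: Zero_fract_def)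
  obtain p' q' where h: "h = Fract p' q'" "q' \<noteq> 0" by (cases h rule: Fract_cases_nonzero) (auto simp: Zero_fract_def)
  show "fract_deriv D (f + h) = fract_deriv D f + fract_deriv D h"
    using f h by (simp add: fract_deriv_Fract[OF assms] eq_fract add mult)
      (simp add: algebra_simps)
  show "fract_deriv D (f * h) = fract_deriv D f * h + f * fract_deriv D h"
    using f h by (simp add: fract_deriv_Fract[OF assms] eq_fract add mult)
      (simp add: algebra_simps)
qed

lemma derivation_commute_fract:
  fixes D E :: "'a::idom \<Rightarrow> 'a"
  assumes D: "derivation D" and E: "derivation E" and c: "\<And>p. D (E p) = E (D p)"
  shows "fract_deriv D (fract_deriv E f) = fract_deriv E (fract_deriv D f)"
proof -
  interpret D: derivation "fract_deriv D" by (rule derivation_fract_deriv[OF D])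
  interpret E: derivation "fract_deriv E" by (rule derivation_fract_deriv[OF E])
  interpret D0: derivation D by fact
  interpret E0: derivation E by fact
  define C where "C f = fract_deriv D (fract_deriv E f) - fract_deriv E (fract_deriv D f)" for f
  have C0: "C (Fract p 1) = 0" for p
    by (simp add: C_def fract_deriv_Fract[OF D] fract_deriv_Fract[OF E] D0.one E0.one c)
  have Cm: "C (f * h) = C f * h + f * C h" for f h
    by (simp add: C_def D.mult E.mult D.add E.add algebra_simps)
  obtain p q where f: "f = Fract p q" "q \<noteq> 0"
    by (cases f rule: Fract_cases_nonzero) (auto simp: Zero_fract_def)
  have "f * Fract q 1 = Fract p 1" using f by (simp add: eq_fract)
  then have "C f * Fract q 1 = 0" using Cm[of f "Fract q 1"] C0 by simp
  moreover have "Fract q 1 \<noteq> 0" using f by (simp add: Zero_fract_def eq_fract)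
  ultimately have "C f = 0" by simp
  then show ?thesis by (simp add: C_def)
qed

lemma derivation_pderiv: "derivation (pderiv :: 'a::idom poly \<Rightarrow> _)"
  by standard (simp_all add: pderiv_add pderiv_mult algebra_simps)

lemma derivation_map_poly:
  fixes D :: "'a::idom \<Rightarrow> 'a"
  assumes "derivation D"
  shows "derivation (map_poly D)"
proof
  interpret derivation D by fact
  show add': "map_poly D (f + h) = map_poly D f + map_poly D h" for f h
    by (rule poly_eqI) (simp add: coeff_map_poly zero add)
  have sm: "map_poly D (smult a h) = smult (D a) h + smult a (map_poly D h)" for a h
    by (rule poly_eqI) (simp add: coeff_map_poly zero mult)
  show "map_poly D (f * h) = map_poly D f * h + f * map_poly D h" for f h
    by (induction f) (simp_all add: add' sm zero map_poly_pCons algebra_simps)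
qed

lemma map_poly_pderiv_commute:
  "map_poly pderiv (pderiv p) = pderiv (map_poly pderiv (p :: 'a::idom poly poly))"
  by (rule poly_eqI)
    (simp add: coeff_map_poly coeff_pderiv pderiv_mult pderiv_add flip: of_nat_Suc)

interpretation rf_dx: derivation rf_dx
  unfolding rf_dx_def by (intro derivation_fract_deriv derivation_map_poly derivation_pderiv)

interpretation rf_dy: derivation rf_dy
  unfolding rf_dy_def by (intro derivation_fract_deriv derivation_pderiv)

lemma rf_dx_rf_dy: "rf_dx (rf_dy f) = rf_dy (rf_dx f)"
  unfolding rf_dx_def rf_dy_def
  by (intro derivation_commute_fract derivation_map_poly derivation_pderiv map_poly_pderiv_commute)

lemma rf_derivs [simp]:
  "rf_dx rf_x = 1" "rf_dx rf_y = 0" "rf_dy rf_x = 0" "rf_dy rf_y = 1"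
  "rf_dx (rf_const t) = 0" "rf_dy (rf_const t) = 0"
  using derivation_map_poly[OF derivation_pderiv, where 'a1 = complex] derivation_pderiv[where 'a = "complex poly"]
  by (simp_all add: rf_dx_def rf_dy_def rf_x_def rf_y_def rf_const_def fract_deriv_Fract
      map_poly_pCons pderiv_pCons One_fract_def Zero_fract_def eq_fract one_pCons)

lemma rf_brk_x_y: "rf_brk rf_x rf_y = rf_x"
  by (simp add: rf_brk_def)

lemma rf_const_hom:
  "rf_const (s + t) = rf_const s + rf_const t" "rf_const (s * t) = rf_const s * rf_const t"
  "rf_const (s - t) = rf_const s - rf_const t"
  "rf_const 1 = 1" "rf_const 0 = 0" "rf_const s = 0 \<longleftrightarrow> s = 0"
  by (simp_all add: rf_const_def One_fract_def Zero_fract_def eq_fract one_pCons)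

lemma rf_x_nonzero: "rf_x \<noteq> 0"
  by (simp add: rf_x_def Zero_fract_def eq_fract)

lemma poisson_algebra_rf: "poisson_algebra (\<lambda>t f. rf_const t * f) rf_brk"
proof unfold_locales
  show "rf_brk f (rf_brk h k) + rf_brk h (rf_brk k f) + rf_brk k (rf_brk f h) = 0" for f h k
    by (simp add: rf_brk_def rf_dx.mult rf_dy.mult rf_dx.diff rf_dy.diff rf_dx_rf_dy)
      (simp add: algebra_simps)
qed (simp_all add: rf_const_hom rf_brk_def rf_dx.add rf_dy.add rf_dx.mult rf_dy.mult
      algebra_simps)

lemma kahler_poisson_kp_xy:
  assumes "transpose g = g" and "det g \<noteq> 0"
  shows "kahler_poisson (kp_xy g)"
proof -
  have s: "g $ 2 $ 1 = g $ 1 $ 2"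
    using arg_cong[OF assms(1), of "\<lambda>m. m $ 1 $ 2"] by (simp add: transpose_def)
  have d: "g $ 1 $ 1 * g $ 2 $ 2 - g $ 1 $ 2 * g $ 1 $ 2 \<noteq> 0"
    using assms(2) by (simp add: det_2 s)
  define \<eta> where "\<eta> = 1 / (rf_x ^ 2 * (g $ 1 $ 1 * g $ 2 $ 2 - g $ 1 $ 2 * g $ 1 $ 2))"
  have \<eta>: "\<eta> * rf_x * rf_x * (g $ 1 $ 1 * g $ 2 $ 2 - g $ 1 $ 2 * g $ 1 $ 2) = 1"
    using d rf_x_nonzero by (simp add: \<eta>_def power2_eq_square)
  have "(\<Sum>i\<in>UNIV. \<Sum>j\<in>UNIV. \<Sum>k\<in>UNIV. \<Sum>l\<in>UNIV.
           \<eta> * kp_brk (kp_xy g) a (kp_gens (kp_xy g) $ i) * kp_metric (kp_xy g) $ i $ j *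
           kp_brk (kp_xy g) (kp_gens (kp_xy g) $ j) (kp_gens (kp_xy g) $ k) *
           kp_metric (kp_xy g) $ k $ l *
           kp_brk (kp_xy g) (kp_gens (kp_xy g) $ l) b)
        = - (\<eta> * rf_x * rf_x * (g $ 1 $ 1 * g $ 2 $ 2 - g $ 1 $ 2 * g $ 1 $ 2)) * rf_brk a b" for a b
    by (simp add: kp_xy_def sum_2 s rf_brk_def) (simp add: algebra_simps)
  then show ?thesis
    unfolding kahler_poisson_def using assms(1) poisson_algebra_rf
    by (auto simp: \<eta> kp_xy_def intro!: exI[of _ \<eta>])
qed

corollary kahler_poisson_kp_xy_const:
  fixes g :: "complex ^ 2 ^ 2"
  assumes "transpose g = g" and "det g \<noteq> 0"
  shows "kahler_poisson (kp_xy (map_matrix rf_const g))"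
proof (rule kahler_poisson_kp_xy)
  show "transpose (map_matrix rf_const g) = map_matrix rf_const g"
    using assms(1) by (simp add: transpose_def vec_eq_iff)
  have "det (map_matrix rf_const g) = rf_const (det g)"
    by (simp add: det_2 rf_const_hom)
  then show "det (map_matrix rf_const g) \<noteq> 0"
    using assms(2) by (simp add: rf_const_hom)
qed

end

theory Submission
  imports Defs "HOL-Computational_Algebra.Polynomial_Factorial"
begin

text \<open>If \<open>\<phi>\<close> is the algebra part of an isomorphism, then \<open>\<phi> x = \<phi> {x, y} = {\<phi> x, \<phi> y} = x J\<close> with
  \<open>J\<close> a polynomial, because \<open>\<phi>\<close> preserves \<open>\<complex>[x, y]\<close>. The same holds for the inverse,
  \<open>\<phi>' x = x J'\<close>, and applying \<open>\<phi>\<close> gives \<open>J * \<phi> J' = 1\<close>, so \<open>J\<close> is a constant \<open>t\<close>. Hence \<open>\<psi>\<close> sends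
  \<open>{x, \<cdot>}\<close> to \<open>t {x, \<cdot>}\<close>, and comparing squared lengths yields \<open>t\<^sup>2 x\<^sup>2 c = t\<^sup>2 x\<^sup>2 c'\<close>. Conversely,
  a linear substitution \<open>x \<mapsto> l x\<close>, \<open>y \<mapsto> y + m x\<close> realises the isomorphism, where \<open>l\<close> and \<open>m\<close> are
  found from \<open>a' = l\<^sup>2 a + 2 l m b + m\<^sup>2 c\<close> and \<open>b' = l b + m c\<close>.\<close>

section \<open>Polynomials inside the field of rational functions, and induction over both\<close>

lemma ratfun_cases:
  fixes f :: ratfun
  obtains p q where "f = to_fract p / to_fract q" "q \<noteq> 0"
  by (cases f rule: Fract_cases_nonzero) (auto simp: Fract_conv_to_fract intro: that[of 0 1])

lemma rf_const_conv: "rf_const t = to_fract [:[:t:]:]"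
  and rf_x_conv: "rf_x = to_fract [:[:0, 1:]:]"
  and rf_y_conv: "rf_y = to_fract [:0, 1:]"
  by (simp_all add: rf_const_def rf_x_def rf_y_def to_fract_def)

lemma to_fract_pCons_pCons:
  "to_fract [:pCons t p:] = rf_const t + rf_x * to_fract [:p:]"
  by (simp add: rf_const_conv rf_x_conv flip: to_fract_mult to_fract_add)

lemma to_fract_pCons: "to_fract (pCons p q) = to_fract [:p:] + rf_y * to_fract q"
  by (simp add: rf_y_conv flip: to_fract_mult to_fract_add)

lemma polynomial_induct [case_names const x y add mult]:
  fixes p :: "complex poly poly"
  assumes const: "\<And>t. P (rf_const t)" and x: "P rf_x" and y: "P rf_y"
    and add: "\<And>f h. P f \<Longrightarrow> P h \<Longrightarrow> P (f + h)"
    and mult: "\<And>f h. P f \<Longrightarrow> P h \<Longrightarrow> P (f * h)"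
  shows "P (to_fract p)"
proof (induction p)
  case 0
  show ?case using const[of 0] by (simp add: rf_const_hom)
next
  case (pCons p q)
  have "P (to_fract [:p:])"
  proof (induction p)
    case 0
    show ?case using const[of 0] by (simp add: rf_const_hom)
  next
    case (pCons t p)
    then show ?case
      by (subst to_fract_pCons_pCons) (intro add mult const x)
  qed
  then show ?case
    by (subst to_fract_pCons) (intro add mult y pCons.IH)
qed

text \<open>The case \<open>cancel\<close> takes the place of closure under division: if
  \<open>f = p / q\<close>, then \<open>f * q = p\<close> is a polynomial. Identities built from
  derivations and field homomorphisms can be cancelled in this way without any quotient
  rule.\<close>

lemma ratfun_induct [case_names const x y add mult cancel]:
  fixes f :: ratfun
  assumes "\<And>t. P (rf_const t)" "P rf_x" "P rf_y"
    and "\<And>f h. P f \<Longrightarrow> P h \<Longrightarrow> P (f + h)" "\<And>f h. P f \<Longrightarrow> P h \<Longrightarrow> P (f * h)"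
    and "\<And>f h. P (f * h) \<Longrightarrow> P h \<Longrightarrow> h \<noteq> 0 \<Longrightarrow> P f"
  shows "P f"
proof -
  obtain p q where "f = to_fract p / to_fract q" "q \<noteq> 0" by (rule ratfun_cases)
  then show ?thesis
    using polynomial_induct[of P, OF assms(1-5)] assms(6)[of f "to_fract q"] by simp
qed

section \<open>The finite part, and brackets and units of polynomials\<close>

lemma kp_xy_simps [simp]:
  "kp_smul (kp_xy g) = (\<lambda>t f. rf_const t * f)" "kp_brk (kp_xy g) = rf_brk"
  "kp_metric (kp_xy g) = g" "kp_gens (kp_xy g) $ 1 = rf_x" "kp_gens (kp_xy g) $ 2 = rf_y"
  by (simp_all add: kp_xy_def)

lemma kp_fin_subalgebra: "is_subalgebra (kp_smul K) (kp_fin K)"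
  unfolding kp_fin_def by (rule hull_in) (auto simp: is_subalgebra_def)

text \<open>Turns the condition on finite parts in a morphism into: polynomials go to
  polynomials.\<close>

lemma kp_fin_xy: "kp_fin (kp_xy g) = range to_fract"
proof
  have "is_subalgebra (kp_smul (kp_xy g)) (range to_fract)"
    unfolding is_subalgebra_def
    by (auto simp: rf_const_conv image_iff simp flip: to_fract_mult to_fract_add to_fract_1)
  moreover have "range (($) (kp_gens (kp_xy g))) \<subseteq> range to_fract"
  proof -
    have "\<forall>i. kp_gens (kp_xy g) $ i \<in> range to_fract"
      by (simp only: forall_2) (simp add: rf_x_conv rf_y_conv)
    then show ?thesis by blast
  qed
  ultimately show "kp_fin (kp_xy g) \<subseteq> range to_fract"
    unfolding kp_fin_def by (intro hull_minimal)
next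
  have sub: "1 \<in> kp_fin (kp_xy g)" "\<And>t f. f \<in> kp_fin (kp_xy g) \<Longrightarrow> rf_const t * f \<in> kp_fin (kp_xy g)"
    "\<And>f h. f \<in> kp_fin (kp_xy g) \<Longrightarrow> h \<in> kp_fin (kp_xy g) \<Longrightarrow> f + h \<in> kp_fin (kp_xy g)"
    "\<And>f h. f \<in> kp_fin (kp_xy g) \<Longrightarrow> h \<in> kp_fin (kp_xy g) \<Longrightarrow> f * h \<in> kp_fin (kp_xy g)"
    using kp_fin_subalgebra[of "kp_xy g"] by (auto simp: is_subalgebra_def)
  have gens: "kp_gens (kp_xy g) $ i \<in> kp_fin (kp_xy g)" for i
    unfolding kp_fin_def by (rule hull_inc) simp
  have "to_fract p \<in> kp_fin (kp_xy g)" for p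
    by (rule polynomial_induct[where P = "\<lambda>f. f \<in> kp_fin (kp_xy g)"])
      (use sub(2)[OF sub(1)] gens[of 1] gens[of 2] in \<open>simp_all add: sub(3,4)\<close>)
  then show "range to_fract \<subseteq> kp_fin (kp_xy g)" by blast
qed

lemma rf_dx_to_fract: "rf_dx (to_fract p) = to_fract (map_poly pderiv p)"
  and rf_dy_to_fract: "rf_dy (to_fract p) = to_fract (pderiv p)"
  by (simp_all add: derivation.one[OF derivation_map_poly[OF derivation_pderiv]] rf_dx_def rf_dy_def to_fract_def fract_deriv_Fract
      derivation_map_poly derivation_pderiv)

text \<open>Partial derivatives of polynomials are polynomials, so the factor \<open>x\<close> in
  the bracket splits off.\<close>

lemma rf_brk_to_fract: "\<exists>j. rf_brk (to_fract p) (to_fract q) = rf_x * to_fract j"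
  unfolding rf_brk_def rf_dx_to_fract rf_dy_to_fract
  by (metis to_fract_mult to_fract_diff)

text \<open>Units of a polynomial ring over a domain are units of the coefficient ring; this is
  applied first to \<open>y\<close> and then to \<open>x\<close>.\<close>

lemma polynomial_unit_constant:
  assumes "to_fract p * to_fract q = (1 :: ratfun)"
  obtains t where "t \<noteq> 0" "to_fract p = rf_const t"
proof -
  have "p * q = 1" using assms by (simp flip: to_fract_mult to_fract_1)
  then have "p dvd 1" by (metis dvd_triv_left)
  then obtain r where r: "p = [:r:]" "r dvd 1" by (auto simp: is_unit_poly_iff)
  then obtain t where "r = [:t:]" "t dvd 1" by (auto simp: is_unit_poly_iff)
  then show ?thesis using r that[of t] by (cases "t = 0") (auto simp: rf_const_conv)
qed

lemma rf_brk_mem_kp_derivations: "rf_brk h \<in> kp_derivations (kp_xy g)"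
  unfolding kp_derivations_def
  by (simp, rule exI[of _ "1::nat"], rule exI[of _ "\<lambda>_. 1"], rule exI[of _ "\<lambda>_. h"]) simp

lemma kp_form_xy:
  "kp_form (kp_xy g) \<alpha> \<beta> =
     \<alpha> rf_x * g $ 1 $ 1 * \<beta> rf_x + \<alpha> rf_x * g $ 1 $ 2 * \<beta> rf_y +
     \<alpha> rf_y * g $ 2 $ 1 * \<beta> rf_x + \<alpha> rf_y * g $ 2 $ 2 * \<beta> rf_y"
  by (simp add: kp_form_def sum_2)

section \<open>Isomorphisms preserve the lower right entry of the metric\<close>

lemma poisson_hom_rf_const:
  assumes "poisson_hom (kp_xy g) (kp_xy g') \<phi>"
  shows "\<phi> (rf_const t) = rf_const t"
proof -
  have "\<phi> (rf_const t * 1) = rf_const t * \<phi> 1"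
    using assms unfolding poisson_hom_def
    by (auto simp: Vector_Spaces.linear_iff)
  then show ?thesis using assms by (simp add: poisson_hom_def)
qed

lemma kp_morphism_rf_x:
  assumes "kp_morphism (kp_xy g) (kp_xy g') \<phi> \<psi>"
  obtains j where "\<phi> rf_x = rf_x * to_fract j"
proof -
  have fin: "\<phi> ` range to_fract \<subseteq> range to_fract"
    and brk: "\<And>f h. \<phi> (rf_brk f h) = rf_brk (\<phi> f) (\<phi> h)"
    using assms by (auto simp: kp_morphism_def poisson_hom_def kp_fin_xy)
  obtain p q where "\<phi> rf_x = to_fract p" "\<phi> rf_y = to_fract q"
    using fin by (auto simp: rf_x_conv rf_y_conv) blast
  then show ?thesis
    using that brk[of rf_x rf_y] rf_brk_to_fract[of p q] by (auto simp: rf_brk_x_y)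
qed

lemma kp_isomorphic_imp_metric_eq:
  assumes "kp_isomorphic (kp_xy (map_matrix rf_const g)) (kp_xy (map_matrix rf_const g'))"
  shows "g $ 2 $ 2 = g' $ 2 $ 2"
proof -
  define K K' where "K = kp_xy (map_matrix rf_const g)" and "K' = kp_xy (map_matrix rf_const g')"
  obtain \<phi> \<psi> \<phi>' \<psi>' where m: "kp_morphism K K' \<phi> \<psi>" and m': "kp_morphism K' K \<phi>' \<psi>'"
    and inv: "\<And>f. \<phi> (\<phi>' f) = f"
    using assms unfolding kp_isomorphic_def K_def K'_def by blast
  note K = K_def K'_def
  have hom: "poisson_hom K K' \<phi>" and fin: "\<phi> ` range to_fract \<subseteq> range to_fract"
    and act: "\<And>f \<alpha>. \<alpha> \<in> kp_derivations K \<Longrightarrow> \<phi> (\<alpha> f) = \<psi> \<alpha> (\<phi> f)"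
    and form: "\<And>\<alpha> \<beta>. \<alpha> \<in> kp_derivations K \<Longrightarrow> \<beta> \<in> kp_derivations K \<Longrightarrow>
        \<phi> (kp_form K \<alpha> \<beta>) = kp_form K' (\<psi> \<alpha>) (\<psi> \<beta>)"
    using m by (auto simp: kp_morphism_def K kp_fin_xy)
  have mult: "\<And>f h. \<phi> (f * h) = \<phi> f * \<phi> h" and brk: "\<And>f h. \<phi> (rf_brk f h) = rf_brk (\<phi> f) (\<phi> h)"
    using hom by (auto simp: poisson_hom_def K)
  have const: "\<phi> (rf_const t) = rf_const t" for t
    using poisson_hom_rf_const hom by (simp add: K)
  obtain j where j: "\<phi> rf_x = rf_x * to_fract j"
    using kp_morphism_rf_x m unfolding K by blast
  obtain j' where j': "\<phi>' rf_x = rf_x * to_fract j'"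
    using kp_morphism_rf_x m' unfolding K by blast
  obtain k where k: "\<phi> (to_fract j') = to_fract k" using fin by blast
  have "rf_x = \<phi> (rf_x * to_fract j')" using inv[of rf_x] by (simp add: j')
  also have "\<dots> = rf_x * (to_fract j * to_fract k)" by (simp add: mult j k)
  finally have "to_fract j * to_fract k = (1 :: ratfun)" using rf_x_nonzero by simp
  then obtain t where t: "t \<noteq> 0" "to_fract j = rf_const t" by (rule polynomial_unit_constant)
  have \<alpha>: "rf_brk rf_x \<in> kp_derivations K" by (simp add: K rf_brk_mem_kp_derivations)
  \<comment> \<open>Every argument has the form \<open>\<phi> (\<phi>' f)\<close>, so compatibility
    with the action of derivations forces
    \<open>\<psi> (rf_brk rf_x) = rf_brk (\<phi> rf_x)\<close>.\<close>
  have \<psi>: "\<psi> (rf_brk rf_x) f = rf_brk (rf_x * rf_const t) f" for f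
    using act[OF \<alpha>, of "\<phi>' f"] by (simp add: inv brk j t)
  \<comment> \<open>Both derivations annihilate \<open>x\<close>, so only the lower right entry
    contributes to either squared length.\<close>
  have "\<phi> (kp_form K (rf_brk rf_x) (rf_brk rf_x)) =
      (rf_x * rf_const t)\<^sup>2 * rf_const (g $ 2 $ 2)"
    by (simp add: K kp_form_xy rf_brk_def mult const j t power2_eq_square)
  moreover have "kp_form K' (\<psi> (rf_brk rf_x)) (\<psi> (rf_brk rf_x)) =
      (rf_x * rf_const t)\<^sup>2 * rf_const (g' $ 2 $ 2)"
    by (simp add: K kp_form_xy \<psi> rf_brk_def rf_dx.mult rf_dy.mult power2_eq_square)
  ultimately have "rf_const (g $ 2 $ 2) = rf_const (g' $ 2 $ 2)"
    using form[OF \<alpha> \<alpha>] t rf_x_nonzero by (simp add: rf_const_hom)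
  then show ?thesis using rf_const_hom(3,6) by (metis eq_iff_diff_eq_0)
qed

section \<open>Extending injective ring homomorphisms to polynomials and fractions\<close>

definition fract_map :: "('a::idom \<Rightarrow> 'b::idom) \<Rightarrow> 'a fract \<Rightarrow> 'b fract" where
  "fract_map \<sigma> f = (THE r. \<exists>p q. q \<noteq> 0 \<and> f = Fract p q \<and> r = Fract (\<sigma> p) (\<sigma> q))"

text \<open>Injectivity, in the form \<open>eq_0_iff\<close>, keeps denominators nonzero; this makes
  \<open>fract_map\<close> independent of the chosen fraction.\<close>

locale idom_embedding =
  fixes \<sigma> :: "'a::idom \<Rightarrow> 'b::idom"
  assumes add: "\<sigma> (p + q) = \<sigma> p + \<sigma> q"
    and mult: "\<sigma> (p * q) = \<sigma> p * \<sigma> q"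
    and one: "\<sigma> 1 = 1"
    and eq_0_iff: "\<sigma> p = 0 \<longleftrightarrow> p = 0"
begin

lemma fract_map_Fract:
  assumes "q \<noteq> 0"
  shows "fract_map \<sigma> (Fract p q) = Fract (\<sigma> p) (\<sigma> q)"
  unfolding fract_map_def
proof (rule the_equality)
  fix r
  assume "\<exists>p' q'. q' \<noteq> 0 \<and> Fract p q = Fract p' q' \<and> r = Fract (\<sigma> p') (\<sigma> q')"
  then obtain p' q' where *: "q' \<noteq> 0" "Fract p q = Fract p' q'" "r = Fract (\<sigma> p') (\<sigma> q')"
    by blast
  then have "\<sigma> (p * q') = \<sigma> (p' * q)" using assms by (simp add: eq_fract)
  then show "r = Fract (\<sigma> p) (\<sigma> q)"
    using * assms by (simp add: eq_fract eq_0_iff mult)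
qed (use assms in blast)

lemma fract_map_to_fract: "fract_map \<sigma> (to_fract p) = to_fract (\<sigma> p)"
  by (simp add: to_fract_def fract_map_Fract one)

lemma fract_map_embedding: "idom_embedding (fract_map \<sigma>)"
proof
  fix f h :: "'a fract"
  obtain p q where f: "f = Fract p q" "q \<noteq> 0"
    by (cases f rule: Fract_cases_nonzero) (auto simp: Zero_fract_def)
  obtain p' q' where h: "h = Fract p' q'" "q' \<noteq> 0"
    by (cases h rule: Fract_cases_nonzero) (auto simp: Zero_fract_def)
  show "fract_map \<sigma> (f + h) = fract_map \<sigma> f + fract_map \<sigma> h"
    "fract_map \<sigma> (f * h) = fract_map \<sigma> f * fract_map \<sigma> h"
    using f h by (simp_all add: fract_map_Fract add mult eq_0_iff)
  show "fract_map \<sigma> f = 0 \<longleftrightarrow> f = 0"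
    using f by (simp add: fract_map_Fract Zero_fract_def eq_fract eq_0_iff)
  show "fract_map \<sigma> 1 = 1"
    by (simp add: One_fract_def fract_map_Fract one)
qed

lemma map_poly_embedding: "idom_embedding (map_poly \<sigma>)"
proof
  have z: "\<sigma> 0 = 0" by (simp add: eq_0_iff)
  show add': "map_poly \<sigma> (p + q) = map_poly \<sigma> p + map_poly \<sigma> q" for p q
    by (rule poly_eqI) (simp add: coeff_map_poly z add)
  have sm: "map_poly \<sigma> (smult a p) = smult (\<sigma> a) (map_poly \<sigma> p)" for a p
    by (rule poly_eqI) (simp add: coeff_map_poly z mult)
  show "map_poly \<sigma> (p * q) = map_poly \<sigma> p * map_poly \<sigma> q" for p q
    by (induction p) (simp_all add: add' sm z map_poly_pCons)
  show "map_poly \<sigma> 1 = 1" by (simp add: one_pCons map_poly_pCons z one)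
  show "map_poly \<sigma> p = 0 \<longleftrightarrow> p = 0" for p
    by (simp add: poly_eq_iff coeff_map_poly z eq_0_iff)
qed

end

section \<open>The linear substitution and its compatibility with the bracket\<close>

lemma pcompose_embedding:
  fixes q :: "'a::idom poly"
  assumes "degree q > 0"
  shows "idom_embedding (\<lambda>p. pcompose p q)"
  \<comment> \<open>Composition with a constant would be evaluation, which has a kernel; the degree
    condition excludes this.\<close>
  using assms by unfold_locales (auto simp: pcompose_add pcompose_mult pcompose_1 pcompose_eq_0_iff)

text \<open>The coefficientwise composition sends \<open>x\<close> to \<open>l x\<close>; the outer
  one, performed afterwards, sends \<open>y\<close> to \<open>y + m x\<close> with \<open>x\<close>
  not rescaled.\<close>

definition rf_subst :: "complex \<Rightarrow> complex \<Rightarrow> ratfun \<Rightarrow> ratfun" where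
  "rf_subst l m =
     fract_map (\<lambda>p. pcompose (map_poly (\<lambda>q. pcompose q [:0, l:]) p) [:[:0, m:], 1:])"

context
  fixes l m :: complex
  assumes l: "l \<noteq> 0"
begin

lemma rf_subst_poly_embedding:
  "idom_embedding (\<lambda>p. pcompose (map_poly (\<lambda>q. pcompose q [:0, l:]) p) [:[:0, m:], 1:])"
proof -
  interpret inner: idom_embedding "\<lambda>q. pcompose q [:0, l:]"
    by (rule pcompose_embedding) (simp add: l)
  interpret coeffs: idom_embedding "map_poly (\<lambda>q. pcompose q [:0, l:])"
    by (rule inner.map_poly_embedding)
  interpret outer: idom_embedding "\<lambda>p. pcompose p [:[:0, m:], 1:]"
    by (rule pcompose_embedding) simp
  show ?thesis
    by unfold_locales
      (simp_all only: coeffs.add outer.add coeffs.mult outer.mult coeffs.one outer.one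
        coeffs.eq_0_iff outer.eq_0_iff)
qed

interpretation poly: idom_embedding
  "\<lambda>p. pcompose (map_poly (\<lambda>q. pcompose q [:0, l:]) p) [:[:0, m:], 1:]"
  by (rule rf_subst_poly_embedding)

interpretation subst: idom_embedding "rf_subst l m"
  unfolding rf_subst_def by (rule poly.fract_map_embedding)

lemma rf_subst_simps:
  "rf_subst l m (f + h) = rf_subst l m f + rf_subst l m h"
  "rf_subst l m (f * h) = rf_subst l m f * rf_subst l m h"
  "rf_subst l m (f - h) = rf_subst l m f - rf_subst l m h"
  "rf_subst l m 1 = 1"
  "rf_subst l m 0 = 0"
  "rf_subst l m f = 0 \<longleftrightarrow> f = 0"
  "rf_subst l m (rf_const t) = rf_const t"
  "rf_subst l m rf_x = rf_const l * rf_x"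
  "rf_subst l m rf_y = rf_y + rf_const m * rf_x"
proof -
  show "rf_subst l m (f - h) = rf_subst l m f - rf_subst l m h"
    using subst.add[of "f - h" h] by simp
  show "rf_subst l m (rf_const t) = rf_const t" "rf_subst l m rf_x = rf_const l * rf_x"
    "rf_subst l m rf_y = rf_y + rf_const m * rf_x"
    unfolding rf_subst_def rf_const_conv rf_x_conv rf_y_conv poly.fract_map_to_fract
    by (simp_all add: map_poly_pCons pcompose_pCons pcompose_1 flip: to_fract_mult to_fract_add)
qed (simp_all add: subst.add subst.mult subst.one subst.eq_0_iff)

lemma rf_subst_sum: "rf_subst l m (\<Sum>i\<in>A. f i) = (\<Sum>i\<in>A. rf_subst l m (f i))"
  by (induction A rule: infinite_finite_induct) (simp_all add: rf_subst_simps)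

lemma rf_subst_to_fract: "rf_subst l m (to_fract p) \<in> range to_fract"
  by (simp add: rf_subst_def poly.fract_map_to_fract)

text \<open>The chain rule: the image of \<open>x\<close> depends on \<open>x\<close> alone, while
  the image of \<open>y\<close> has partial derivatives \<open>m\<close> and
  \<open>1\<close>.\<close>

lemma rf_subst_derivs:
  "rf_dx (rf_subst l m f) =
     rf_const l * rf_subst l m (rf_dx f) + rf_const m * rf_subst l m (rf_dy f)" (is "?X f")
  "rf_dy (rf_subst l m f) = rf_subst l m (rf_dy f)" (is "?Y f")
proof -
  have "?X f \<and> ?Y f"
  proof (induction f rule: ratfun_induct)
    case (cancel f h)
    \<comment> \<open>The Leibniz rule for \<open>f * h\<close>, minus the claim for
      \<open>h\<close>, gives the claim for \<open>f\<close> multiplied by the image of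
      \<open>h\<close>, which is nonzero.\<close>
    then have "rf_dx (rf_subst l m f) * rf_subst l m h =
        (rf_const l * rf_subst l m (rf_dx f) + rf_const m * rf_subst l m (rf_dy f)) * rf_subst l m h"
      "rf_dy (rf_subst l m f) * rf_subst l m h = rf_subst l m (rf_dy f) * rf_subst l m h"
      by (simp_all add: rf_subst_simps rf_dx.mult rf_dy.mult algebra_simps)
    with cancel(3) show ?case by (simp add: rf_subst_simps)
  qed (simp_all add: rf_subst_simps rf_dx.add rf_dx.mult rf_dy.add rf_dy.mult algebra_simps)
  then show "?X f" "?Y f" by auto
qed

text \<open>The Jacobian determinant of the substitution is \<open>l\<close>, which matches the
  factor \<open>l\<close> picked up by the \<open>x\<close> in front of the bracket.\<close>

lemma rf_subst_brk:
  "rf_subst l m (rf_brk f h) = rf_brk (rf_subst l m f) (rf_subst l m h)"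
  by (simp add: rf_brk_def rf_subst_derivs rf_subst_simps algebra_simps)

end

text \<open>The parameters are those of the inverse linear map: \<open>y + m x\<close> goes to
  \<open>y - (m / l) x + m (x / l) = y\<close>.\<close>

lemma rf_subst_inverse:
  assumes "l \<noteq> 0"
  shows "rf_subst (1 / l) (- (m / l)) (rf_subst l m f) = f"
proof -
  have l': "1 / l \<noteq> 0" using assms by simp
  note simps = rf_subst_simps[OF assms] rf_subst_simps[OF l']
  have unit: "rf_const l * rf_const (1 / l) = 1" "rf_const (- (m / l)) + rf_const m * rf_const (1 / l) = 0"
    using assms by (simp_all flip: rf_const_hom)
  show ?thesis
  proof (induction f rule: ratfun_induct)
    case x
    show ?case using unit by (simp add: simps mult.assoc[symmetric])
  next
    case y
    have "rf_subst (1 / l) (- (m / l)) (rf_subst l m rf_y) =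
        rf_y + (rf_const (- (m / l)) + rf_const m * rf_const (1 / l)) * rf_x"
      by (simp add: simps algebra_simps)
    then show ?case by (simp add: unit)
  next
    case (cancel f h)
    then show ?case by (simp add: simps)
  qed (simp_all add: simps)
qed

section \<open>Push-forward of derivations and the resulting morphism\<close>

lemma kp_derivation_derivation:
  assumes "\<alpha> \<in> kp_derivations (kp_xy g)"
  shows "derivation \<alpha>" "\<alpha> (rf_const t) = 0"
proof -
  obtain n :: nat and u c where \<alpha>: "\<alpha> = (\<lambda>f. \<Sum>i<n. u i * rf_brk (c i) f)"
    using assms by (auto simp: kp_derivations_def)
  show "derivation \<alpha>"
    by unfold_locales
      (simp_all add: \<alpha> rf_brk_def rf_dx.add rf_dy.add rf_dx.mult rf_dy.mult
        sum_distrib_left sum_distrib_right flip: sum.distrib, simp_all add: algebra_simps)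
  show "\<alpha> (rf_const t) = 0" by (simp add: \<alpha> rf_brk_def)
qed

text \<open>Conjugation by the substitution (for \<open>l \<noteq> 0\<close>), the only choice of
  \<open>\<psi>\<close> compatible with the action of derivations.\<close>

definition rf_push :: "complex \<Rightarrow> complex \<Rightarrow> (ratfun \<Rightarrow> ratfun) \<Rightarrow> ratfun \<Rightarrow> ratfun" where
  "rf_push l m \<alpha> = (\<lambda>f. rf_subst l m (\<alpha> (rf_subst (1 / l) (- (m / l)) f)))"

lemma rf_push_inverse:
  assumes "l \<noteq> 0"
  shows "rf_push (1 / l) (- (m / l)) (rf_push l m \<alpha>) = \<alpha>"
  using assms rf_subst_inverse[of "1 / l" "- (m / l)"]
  by (simp add: rf_push_def rf_subst_inverse)

text \<open>The assumptions \<open>pullback\<close> say that \<open>g'\<close> is the transpose of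
  \<open>P\<close> times \<open>g\<close> times \<open>P\<close>, where \<open>P\<close> has rows
  \<open>(l, 0)\<close> and \<open>(m, 1)\<close>: the matrix of the substitution on the
  generators.\<close>

lemma kp_morphism_rf_subst:
  fixes g g' :: "complex ^ 2 ^ 2"
  assumes l: "l \<noteq> 0"
    and kp: "kahler_poisson (kp_xy (map_matrix rf_const g))"
      "kahler_poisson (kp_xy (map_matrix rf_const g'))"
    and sym: "g $ 2 $ 1 = g $ 1 $ 2" "g' $ 2 $ 1 = g' $ 1 $ 2"
    and pullback: "g' $ 1 $ 1 = l\<^sup>2 * g $ 1 $ 1 + 2 * l * m * g $ 1 $ 2 + m\<^sup>2 * g $ 2 $ 2"
      "g' $ 1 $ 2 = l * g $ 1 $ 2 + m * g $ 2 $ 2" "g' $ 2 $ 2 = g $ 2 $ 2"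
  shows "kp_morphism (kp_xy (map_matrix rf_const g)) (kp_xy (map_matrix rf_const g'))
    (rf_subst l m) (rf_push l m)"
    (is "kp_morphism ?K ?K' _ _")
proof -
  have l': "1 / l \<noteq> 0" using l by simp
  note simps = rf_subst_simps[OF l]
  note inv = rf_subst_inverse[OF l]
  \<comment> \<open>Inverting the parameters twice gives back \<open>l\<close> and
    \<open>m\<close>.\<close>
  have inv': "rf_subst l m (rf_subst (1 / l) (- (m / l)) f) = f" for f
    using rf_subst_inverse[OF l', of "- (m / l)" f] l by simp
  have hom: "poisson_hom ?K ?K' (rf_subst l m)"
    using kp unfolding poisson_hom_def
    by (auto simp: Vector_Spaces.linear_iff kahler_poisson_def poisson_algebra_def simps rf_subst_brk[OF l])
  have mem: "rf_push l m \<alpha> \<in> kp_derivations ?K'" if mem: "\<alpha> \<in> kp_derivations ?K" for \<alpha>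
  proof -
    obtain n :: nat and u c where \<alpha>: "\<alpha> = (\<lambda>f. \<Sum>i<n. u i * rf_brk (c i) f)"
      using mem by (auto simp: kp_derivations_def)
    \<comment> \<open>Since the substitution preserves brackets, conjugation carries the inner
      derivation of \<open>c i\<close> to that of its image.\<close>
    have "rf_push l m \<alpha> = (\<lambda>f. \<Sum>i<n. rf_subst l m (u i) * rf_brk (rf_subst l m (c i)) f)"
      by (simp add: rf_push_def \<alpha> rf_subst_sum[OF l] simps rf_subst_brk[OF l] inv')
    then show ?thesis
      unfolding kp_derivations_def kp_xy_simps by (intro CollectI exI)
  qed
  have lie: "derivation_lie_hom ?K ?K' (rf_push l m)"
    unfolding derivation_lie_hom_def
    by (auto simp: mem[unfolded rf_push_def] rf_push_def deriv_commutator_def simps inv)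
  have form: "rf_subst l m (kp_form ?K \<alpha> \<beta>) = kp_form ?K' (rf_push l m \<alpha>) (rf_push l m \<beta>)"
    if "\<alpha> \<in> kp_derivations ?K" "\<beta> \<in> kp_derivations ?K" for \<alpha> \<beta>
  proof -
    \<comment> \<open>Compatibility with the action, evaluated at \<open>x\<close> and
      \<open>y\<close>: applying \<open>P\<close> to the values of the pushed derivation on the
      generators gives the substituted values of \<open>\<gamma>\<close>.\<close>
    have gens: "rf_subst l m (\<gamma> rf_x) = rf_const l * rf_push l m \<gamma> rf_x"
      "rf_subst l m (\<gamma> rf_y) = rf_push l m \<gamma> rf_y + rf_const m * rf_push l m \<gamma> rf_x"
      if "\<gamma> \<in> kp_derivations ?K" for \<gamma>
    proof -
      interpret \<gamma>: derivation \<gamma> using kp_derivation_derivation(1)[OF that] .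
      have \<gamma>: "\<gamma> (rf_const t * f) = rf_const t * \<gamma> f" for t f
        by (simp add: \<gamma>.mult kp_derivation_derivation(2)[OF that])
      show x: "rf_subst l m (\<gamma> rf_x) = rf_const l * rf_push l m \<gamma> rf_x"
        using l by (simp add: rf_push_def rf_subst_simps[OF l'] \<gamma> simps
          flip: mult.assoc rf_const_hom(2)) (simp add: rf_const_hom)
      have "rf_const m * rf_const (1 / l) = - rf_const (- (m / l))"
        by (simp add: eq_neg_iff_add_eq_0 flip: rf_const_hom)
      then show "rf_subst l m (\<gamma> rf_y) = rf_push l m \<gamma> rf_y + rf_const m * rf_push l m \<gamma> rf_x"
        by (simp add: rf_push_def rf_subst_simps[OF l'] \<gamma> \<gamma>.add simps flip: mult.assoc)
    qed
    have two: "rf_const 2 = 2"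
      using rf_const_hom(1)[of 1 1] by (simp add: rf_const_hom(4))
    show ?thesis
      by (simp add: two kp_form_xy simps gens[OF that(1)] gens[OF that(2)] sym pullback rf_const_hom
          power2_eq_square mult.assoc) (simp add: algebra_simps)
  qed
  have fin: "rf_subst l m ` kp_fin ?K \<subseteq> kp_fin ?K'"
    using rf_subst_to_fract[OF l] by (auto simp: kp_fin_xy)
  show ?thesis
    unfolding kp_morphism_def
    using kp hom lie form fin by (auto simp: rf_push_def simps inv)
qed

text \<open>The two equations force \<open>a' c - b'\<^sup>2 = l\<^sup>2 (a c - b\<^sup>2)\<close>, which determines \<open>l\<close> up to sign; if
  \<open>c = 0\<close> the second equation already fixes \<open>l\<close>.\<close>

lemma pullback_exists:
  fixes a b c a' b' :: complex
  assumes "a * c - b * b \<noteq> 0" "a' * c - b' * b' \<noteq> 0"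
  obtains l m where "l \<noteq> 0" "a' = l\<^sup>2 * a + 2 * l * m * b + m\<^sup>2 * c" "b' = l * b + m * c"
proof (cases "c = 0")
  case True
  with assms have "b \<noteq> 0" "b' \<noteq> 0" by auto
  then show ?thesis
    \<comment> \<open>With \<open>c = 0\<close> and \<open>l * b = b'\<close>, the first equation is
      linear in \<open>m\<close>: it reads \<open>a' = l\<^sup>2 * a + 2 * m * b'\<close>.\<close>
    using True by (intro that[of "b' / b" "(a' - (b' / b)\<^sup>2 * a) / (2 * b')"]) (auto simp: field_simps)
next
  case False
  define l where "l = csqrt ((a' * c - b' * b') / (a * c - b * b))"
  define m where "m = (b' - l * b) / c"
  have "l\<^sup>2 * (a * c - b * b) = a' * c - b' * b'" using assms by (simp add: l_def)
  moreover have b': "b' = l * b + m * c" using False by (simp add: m_def)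
  \<comment> \<open>Completing the square: \<open>c\<close> times the first right-hand side is
    \<open>l\<^sup>2 * (a * c - b * b) + (l * b + m * c)\<^sup>2\<close>.\<close>
  ultimately have "c * a' = c * (l\<^sup>2 * a + 2 * l * m * b + m\<^sup>2 * c)"
    by (simp add: power2_eq_square algebra_simps)
  then have "a' = l\<^sup>2 * a + 2 * l * m * b + m\<^sup>2 * c" using False by simp
  moreover have "l \<noteq> 0" using assms by (simp add: l_def)
  ultimately show ?thesis using b' that by blast
qed

theorem proposition3p5:
  fixes a b c a' b' c' :: complex and g g' :: "complex ^ 2 ^ 2"
  assumes "g = vector [vector [a, b], vector [b, c]]"
    and "g' = vector [vector [a', b'], vector [b', c']]"
    and "det g \<noteq> 0" and "det g' \<noteq> 0"
  shows "kp_isomorphic (kp_xy (map_matrix rf_const g)) (kp_xy (map_matrix rf_const g')) \<longleftrightarrow> c = c'"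
proof
  assume "kp_isomorphic (kp_xy (map_matrix rf_const g)) (kp_xy (map_matrix rf_const g'))"
  then show "c = c'" using kp_isomorphic_imp_metric_eq[of g g'] assms by simp
next
  assume c: "c = c'"
  have entries: "g $ 1 $ 1 = a" "g $ 1 $ 2 = b" "g $ 2 $ 1 = b" "g $ 2 $ 2 = c"
    "g' $ 1 $ 1 = a'" "g' $ 1 $ 2 = b'" "g' $ 2 $ 1 = b'" "g' $ 2 $ 2 = c"
    using assms c by simp_all
  have "a * c - b * b \<noteq> 0" "a' * c - b' * b' \<noteq> 0"
    using assms(3,4) by (simp_all add: det_2 entries)
  then obtain l m where l: "l \<noteq> 0" and a': "a' = l\<^sup>2 * a + 2 * l * m * b + m\<^sup>2 * c"
    and b': "b' = l * b + m * c"
    by (rule pullback_exists)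
  have kp: "kahler_poisson (kp_xy (map_matrix rf_const g))"
    "kahler_poisson (kp_xy (map_matrix rf_const g'))"
    using assms(3,4)
    by (auto intro!: kahler_poisson_kp_xy_const simp: transpose_def vec_eq_iff forall_2 entries)
  have l': "1 / l \<noteq> 0" using l by simp
  have inv: "rf_subst l m (rf_subst (1 / l) (- (m / l)) f) = f"
    "rf_push l m (rf_push (1 / l) (- (m / l)) \<alpha>) = \<alpha>" for f \<alpha>
    using rf_subst_inverse[OF l', of "- (m / l)" f] rf_push_inverse[OF l', of "- (m / l)" \<alpha>] l by simp_all
  have "kp_morphism (kp_xy (map_matrix rf_const g)) (kp_xy (map_matrix rf_const g'))
      (rf_subst l m) (rf_push l m)"
    by (rule kp_morphism_rf_subst) (use l kp in \<open>simp_all add: entries a' b'\<close>)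
  \<comment> \<open>The inverse parameters solve the pullback equations with the two metrics
    exchanged, since \<open>P\<close> is invertible.\<close>
  moreover have "kp_morphism (kp_xy (map_matrix rf_const g')) (kp_xy (map_matrix rf_const g))
      (rf_subst (1 / l) (- (m / l))) (rf_push (1 / l) (- (m / l)))"
    by (rule kp_morphism_rf_subst)
      (use l kp in \<open>simp_all add: entries a' b' field_simps power2_eq_square\<close>)
  ultimately show "kp_isomorphic (kp_xy (map_matrix rf_const g)) (kp_xy (map_matrix rf_const g'))"
    unfolding kp_isomorphic_def
    using rf_subst_inverse[OF l] rf_push_inverse[OF l] inv by blast
qed

end
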